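(* Let $G$ be a finite group of order $|G|$. Let $B$ be a left semisimple ring with local units satisfying $|G|B = B$. Then the group ring $A = B[G]$ is left semisimple.
   Context: Rings are associative but not necessarily unital. A ring $B$ is a ring with local units if for each finite subset $X\subseteq B$ there is an idempotent $e\in B$ with $ex=x=xe$ for all $x\in X$. Here $|G|B=\{|G|\,b: b\in B\}$. The group ring $B[G]$ is the set of formal sums $\sum_{g\in G}b_g g$ with $b_g\in B$, with componentwise addition and multiplication determined by $(bg)(b'g')=(bb')(gg')$. A left $A$-module is an additive group $M$ with a biadditive map $A\times M\to M$, $(a,m)\mapsto am$, satisfying $(aa')m=a(a'm)$. $M$ is firm if the map $A\otimes_A M\to M$, $a\otimes m\mapsto am$, is an isomorphism, and s-unital if $m\in Am$ for all $m\in M$. A ring $A$ is left s-unital if it is s-unital as a left $A$-module (every ring with local units is left s-unital, and over a left s-unital ring $M$ is firm iff it is s-unital iff $AM=M$). ${}_A\mathrm{FMod}$ is the category of firm left $A$-modules and $A$-linear maps. Let $A$ be left s-unital and $M\in{}_A\mathrm{FMod}$. A submodule of $M$ in ${}_A\mathrm{FMod}$ is an $A$-submodule of $M$ that is firm. $M$ is simple in ${}_A\mathrm{FMod}$ if it is nonzero and its only submodules in ${}_A\mathrm{FMod}$ are $0$ and $M$. $M$ is semisimple in ${}_A\mathrm{FMod}$ if it is the direct sum of a (possibly empty) family of simple submodules in ${}_A\mathrm{FMod}$. The ring $A$ is left semisimple if $A$, as a left $A$-module, is semisimple in ${}_A\mathrm{FMod}$. *)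

theory Defs
  imports "HOL-Algebra.Free_Abelian_Groups" "HOL-Library.Poly_Mapping" "HOL-Library.Cardinality"
begin

text \<open>
  The type class \<open>ring\<close> is the class of associative rings that need not have a unit; it serves
  here as the class of coefficient rings. A finite group is a type of class
  \<open>{finite, group_add}\<close>. That class is written additively but is not assumed commutative, so
  \<open>g + h\<close> stands for the group product \<open>gh\<close>.
\<close>

text \<open>
  The group ring \<open>B[G]\<close>. Addition on \<^typ>\<open>'g \<Rightarrow>\<^sub>0 'b\<close> is pointwise, and multiplication is
  convolution; with \<open>single g b\<close> for the formal term \<open>b g\<close>, the latter is determined by the
  multiplication rule below.
\<close>

type_synonym ('b, 'g) group_ring = "'g \<Rightarrow>\<^sub>0 'b"

lemma group_ring_mult_single:
  fixes b b' :: "'b::ring" and g g' :: "'g::{finite, group_add}"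
  shows "(Poly_Mapping.single g b :: ('b, 'g) group_ring) * Poly_Mapping.single g' b' =
           Poly_Mapping.single (g + g') (b * b')"
  by (rule mult_single)

definition has_local_units :: "'a::ring itself \<Rightarrow> bool" where
  "has_local_units _ \<longleftrightarrow>
     (\<forall>X :: 'a set. finite X \<longrightarrow> (\<exists>e. e * e = e \<and> (\<forall>x\<in>X. e * x = x \<and> x * e = x)))"

text \<open>The multiple \<open>n b\<close>; a ring without unit offers no \<open>of_nat n * b\<close>.\<close>

definition nat_multiple :: "nat \<Rightarrow> 'a::ab_group_add \<Rightarrow> 'a" where
  "nat_multiple n b = (\<Sum>_<n. b)"

text \<open>
  Left modules over the ring \<open>'a\<close> are additive subgroups \<open>M\<close> of an ambient abelian group \<open>'m\<close>
  together with an action that need only be well-behaved on \<open>M\<close>.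
\<close>

definition left_module :: "('a::ring \<Rightarrow> 'm::ab_group_add \<Rightarrow> 'm) \<Rightarrow> 'm set \<Rightarrow> bool" where
  "left_module act M \<longleftrightarrow>
     0 \<in> M \<and> (\<forall>m\<in>M. \<forall>m'\<in>M. m + m' \<in> M) \<and> (\<forall>m\<in>M. - m \<in> M) \<and>
     (\<forall>a. \<forall>m\<in>M. act a m \<in> M) \<and>
     (\<forall>a a'. \<forall>m\<in>M. act (a + a') m = act a m + act a' m) \<and>
     (\<forall>a. \<forall>m\<in>M. \<forall>m'\<in>M. act a (m + m') = act a m + act a m') \<and>
     (\<forall>a a'. \<forall>m\<in>M. act (a * a') m = act a (act a' m))"

definition additive_monoid :: "'m::ab_group_add set \<Rightarrow> 'm monoid" where
  "additive_monoid M = \<lparr>carrier = M, monoid.mult = (+), one = 0\<rparr>"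

text \<open>
  The tensor product of the right module \<open>'a\<close> with \<open>M\<close> over \<open>'a\<close>: the free abelian group on the
  pairs \<open>(a, m)\<close>, modulo biadditivity and \<open>(a a', m) = (a, a' m)\<close>.
\<close>

definition tensor_relators ::
    "('a::ring \<Rightarrow> 'm::ab_group_add \<Rightarrow> 'm) \<Rightarrow> 'm set \<Rightarrow> ('a \<times> 'm \<Rightarrow>\<^sub>0 int) set" where
  "tensor_relators act M =
     {frag_of (a + a', m) - frag_of (a, m) - frag_of (a', m) | a a' m. m \<in> M} \<union>
     {frag_of (a, m + m') - frag_of (a, m) - frag_of (a, m') | a m m'. m \<in> M \<and> m' \<in> M} \<union>
     {frag_of (a * a', m) - frag_of (a, act a' m) | a a' m. m \<in> M}"

definition tensor_free :: "'m::ab_group_add set \<Rightarrow> ('a::ring \<times> 'm \<Rightarrow>\<^sub>0 int) monoid" where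
  "tensor_free M = free_Abelian_group (UNIV \<times> M)"

definition tensor_kernel ::
    "('a::ring \<Rightarrow> 'm::ab_group_add \<Rightarrow> 'm) \<Rightarrow> 'm set \<Rightarrow> ('a \<times> 'm \<Rightarrow>\<^sub>0 int) set" where
  "tensor_kernel act M = generate (tensor_free M) (tensor_relators act M)"

definition tensor_product ::
    "('a::ring \<Rightarrow> 'm::ab_group_add \<Rightarrow> 'm) \<Rightarrow> 'm set \<Rightarrow> ('a \<times> 'm \<Rightarrow>\<^sub>0 int) set monoid" where
  "tensor_product act M = tensor_free M Mod tensor_kernel act M"

definition pure_tensor ::
    "('a::ring \<Rightarrow> 'm::ab_group_add \<Rightarrow> 'm) \<Rightarrow> 'm set \<Rightarrow> 'a \<Rightarrow> 'm \<Rightarrow> ('a \<times> 'm \<Rightarrow>\<^sub>0 int) set" where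
  "pure_tensor act M a m = tensor_kernel act M #>\<^bsub>tensor_free M\<^esub> frag_of (a, m)"

text \<open>
  The pure tensors generate the tensor product, so the homomorphism \<open>h\<close> below can only be the
  canonical map; firmness says that this map is an isomorphism.
\<close>

definition firm_module :: "('a::ring \<Rightarrow> 'm::ab_group_add \<Rightarrow> 'm) \<Rightarrow> 'm set \<Rightarrow> bool" where
  "firm_module act M \<longleftrightarrow> left_module act M \<and>
     (\<exists>h \<in> iso (tensor_product act M) (additive_monoid M).
        \<forall>a. \<forall>m\<in>M. h (pure_tensor act M a m) = act a m)"

definition s_unital_module :: "('a::ring \<Rightarrow> 'm::ab_group_add \<Rightarrow> 'm) \<Rightarrow> 'm set \<Rightarrow> bool" where
  "s_unital_module act M \<longleftrightarrow> left_module act M \<and> (\<forall>m\<in>M. \<exists>a. m = act a m)"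

definition left_s_unital_ring :: "'a::ring itself \<Rightarrow> bool" where
  "left_s_unital_ring _ \<longleftrightarrow> s_unital_module ((*) :: 'a \<Rightarrow> 'a \<Rightarrow> 'a) UNIV"

definition firm_submodule ::
    "('a::ring \<Rightarrow> 'm::ab_group_add \<Rightarrow> 'm) \<Rightarrow> 'm set \<Rightarrow> 'm set \<Rightarrow> bool" where
  "firm_submodule act N M \<longleftrightarrow> N \<subseteq> M \<and> firm_module act N"

definition simple_firm_module :: "('a::ring \<Rightarrow> 'm::ab_group_add \<Rightarrow> 'm) \<Rightarrow> 'm set \<Rightarrow> bool" where
  "simple_firm_module act M \<longleftrightarrow> firm_module act M \<and> M \<noteq> {0} \<and>
     (\<forall>N. firm_submodule act N M \<longrightarrow> N = {0} \<or> N = M)"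

text \<open>
  The summation map from the external direct sum (finitely supported choices \<open>f i \<in> N i\<close>)
  to \<open>M\<close> is bijective.
\<close>

definition is_direct_sum :: "'i set \<Rightarrow> ('i \<Rightarrow> 'm::ab_group_add set) \<Rightarrow> 'm set \<Rightarrow> bool" where
  "is_direct_sum I N M \<longleftrightarrow>
     bij_betw (\<lambda>f. \<Sum>i\<in>Poly_Mapping.keys f. Poly_Mapping.lookup f i)
       {f :: 'i \<Rightarrow>\<^sub>0 'm. Poly_Mapping.keys f \<subseteq> I \<and> (\<forall>i\<in>I. Poly_Mapping.lookup f i \<in> N i)} M"

text \<open>
  The index type \<^typ>\<open>'m set\<close> is no restriction: the summands of a direct sum of nonzero
  submodules are pairwise distinct, so such a family can be indexed by its own members.
\<close>

definition semisimple_firm_module ::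
    "('a::ring \<Rightarrow> 'm::ab_group_add \<Rightarrow> 'm) \<Rightarrow> 'm set \<Rightarrow> bool" where
  "semisimple_firm_module act M \<longleftrightarrow> firm_module act M \<and>
     (\<exists>(I :: 'm set set) N.
        (\<forall>i\<in>I. firm_submodule act (N i) M \<and> simple_firm_module act (N i)) \<and>
        is_direct_sum I N M)"

definition left_semisimple_ring :: "'a::ring itself \<Rightarrow> bool" where
  "left_semisimple_ring _ \<longleftrightarrow>
     left_s_unital_ring TYPE('a) \<and> semisimple_firm_module ((*) :: 'a \<Rightarrow> 'a \<Rightarrow> 'a) UNIV"

end

theory Submission
  imports Defs "HOL-Library.Set_Algebras"
begin

text \<open>
  The proof is Maschke's averaging argument, with local units in place of the unit and with
  bijectivity of multiplication by \<open>|G|\<close> in place of an inverse of \<open>|G|\<close>.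

  Write \<open>A = B[G]\<close>. Both \<open>B\<close> and \<open>A\<close> have left local units, and over such a ring every submodule
  of an s-unital module is s-unital, hence firm (\<open>firm_module_if_s_unital\<close>). So for \<open>B\<close> and \<open>A\<close>
  as modules over themselves the firm submodules are just the left ideals, and semisimplicity
  becomes a statement about the lattice of all submodules. There it is equivalent to the existence
  of complements: if the simple submodules span the module, then every submodule has a complement
  (\<open>complemented_if_spanned_by_simples\<close>), and if every submodule has a complement, then the module
  is a direct sum of simple submodules (\<open>direct_sum_of_simples_if_complemented\<close>). These two
  implications use only Zorn's lemma and the modular law.

  As a \<open>B\<close>-module, \<open>A\<close> is the sum of the copies \<open>B g\<close> of \<open>B\<close>, so it is spanned by simple
  \<open>B\<close>-submodules (\<open>coeff_act_spanned_by_simples\<close>). Let \<open>N\<close> be a left ideal of \<open>A\<close>. It has a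
  complement as a \<open>B\<close>-submodule and so there is a \<open>B\<close>-linear projection \<open>\<pi>\<close> of \<open>A\<close> onto \<open>N\<close>. The
  unnormalised average \<open>P x = (\<Sum>g. g \<pi> (g\<^sup>-\<^sup>1 x))\<close> is \<open>A\<close>-linear, has values in \<open>N\<close>, and is
  multiplication by \<open>|G|\<close> on \<open>N\<close>. This multiplication is a bijection of \<open>N\<close>: if \<open>b = e b\<close> and
  \<open>e = |G| c\<close>, then \<open>b = |G| (c b)\<close>, which gives surjectivity; and if \<open>b = b e\<close> and \<open>e = |G| c\<close>, then
  \<open>b = (|G| b) c\<close>, which gives injectivity. Therefore the kernel of \<open>P\<close> is a left ideal
  complementary to \<open>N\<close> (\<open>group_ring_complemented\<close>).
\<close>

section \<open>Firm modules over rings with left local units\<close>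

definition has_left_local_units :: "'a::ring itself \<Rightarrow> bool" where
  "has_left_local_units _ \<longleftrightarrow> (\<forall>X :: 'a set. finite X \<longrightarrow> (\<exists>e. \<forall>x\<in>X. e * x = x))"

lemma has_local_units_imp_left: "has_local_units TYPE('a::ring) \<Longrightarrow> has_left_local_units TYPE('a)"
  unfolding has_local_units_def has_left_local_units_def by blast

lemma comm_group_additive_monoid:
  assumes "left_module act M"
  shows "comm_group (additive_monoid M)"
proof (rule comm_groupI)
  fix x assume "x \<in> carrier (additive_monoid M)"
  then show "\<exists>y\<in>carrier (additive_monoid M). y \<otimes>\<^bsub>additive_monoid M\<^esub> x = \<one>\<^bsub>additive_monoid M\<^esub>"
    using assms by (intro bexI[of _ "- x"]) (auto simp: additive_monoid_def left_module_def)
qed (use assms in \<open>auto simp: additive_monoid_def left_module_def algebra_simps\<close>)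

text \<open>
  Modulo the relators every element \<open>x\<close> of the free group is congruent to a single pair \<open>(e, v)\<close>,
  where \<open>e\<close> fixes the ring elements occurring in \<open>x\<close> and \<open>v\<close> is the value of \<open>x\<close> in \<open>M\<close>:
  indeed \<open>(a, m) = (e a, m) = (e, a m)\<close>. If the value is \<open>0\<close>, then \<open>x\<close> is congruent to
  \<open>(e, 0)\<close> and hence to \<open>0\<close>; this makes the canonical map injective.
\<close>
lemma firm_module_if_s_unital:
  fixes act :: "'a::ring \<Rightarrow> 'm::ab_group_add \<Rightarrow> 'm"
  assumes units: "has_left_local_units TYPE('a)" and "s_unital_module act M"
  shows "firm_module act M"
proof -
  have M: "left_module act M" and s: "\<And>m. m \<in> M \<Longrightarrow> \<exists>a. m = act a m"
    using assms(2) by (auto simp: s_unital_module_def)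
  let ?G = "tensor_free M :: ('a \<times> 'm \<Rightarrow>\<^sub>0 int) monoid" and ?H = "additive_monoid M"
  let ?K = "tensor_kernel act M"
  interpret G: group ?G by (simp add: tensor_free_def)
  interpret H: comm_group ?H by (rule comm_group_additive_monoid[OF M])
  have "(\<lambda>(a, m). act a m) ` (UNIV \<times> M) \<subseteq> carrier ?H"
    using M by (auto simp: additive_monoid_def left_module_def)
  from H.free_Abelian_group_universal[OF this] obtain p where
    p: "p \<in> hom ?G ?H" and p_frag: "\<And>a m. m \<in> M \<Longrightarrow> p (frag_of (a, m)) = act a m"
    unfolding tensor_free_def by (metis (no_types, lifting) SigmaI UNIV_I case_prod_conv)
  interpret p: group_hom ?G ?H p
    by unfold_locales (rule p)
  have carrier: "x \<in> carrier ?G \<longleftrightarrow> Poly_Mapping.keys x \<subseteq> UNIV \<times> M" for x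
    by (simp add: tensor_free_def)
  have frag_in: "frag_of (a, m) \<in> carrier ?G" if "m \<in> M" for a m
    using that by (simp add: carrier)
  have inv_eq: "inv\<^bsub>?G\<^esub> x = - x" if "x \<in> carrier ?G" for x
    using that by (simp add: tensor_free_def)
  have mult_eq: "x \<otimes>\<^bsub>?G\<^esub> y = x + y" for x y
    by (simp add: tensor_free_def)
  have minus_in: "x - y \<in> carrier ?G" if "x \<in> carrier ?G" "y \<in> carrier ?G" for x y
    using G.m_closed[OF that(1) G.inv_closed[OF that(2)]] by (simp add: mult_eq inv_eq that)
  have p_minus: "p (x - y) = p x - p y" if "x \<in> carrier ?G" "y \<in> carrier ?G" for x y
  proof -
    have "p ((x - y) \<otimes>\<^bsub>?G\<^esub> y) = p (x - y) \<otimes>\<^bsub>?H\<^esub> p y"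
      using that minus_in by simp
    then show ?thesis by (simp add: mult_eq additive_monoid_def)
  qed
  have act0: "act a 0 = 0" for a
  proof -
    have "act a (0 + 0) = act a 0 + act a 0" using M unfolding left_module_def by blast
    then show ?thesis by simp
  qed
  \<comment> \<open>\<open>p\<close> respects the relators, so it descends to the tensor product.\<close>
  have rel_sub: "tensor_relators act M \<subseteq> kernel ?G ?H p"
  proof -
    have add: "act (a + a') m = act a m + act a' m" if "m \<in> M" for a a' m
      using M that unfolding left_module_def by blast
    have add': "act a (m + m') = act a m + act a m'" if "m \<in> M" "m' \<in> M" for a m m'
      using M that unfolding left_module_def by blast
    have mult: "act (a * a') m = act a (act a' m)" if "m \<in> M" for a a' m
      using M that unfolding left_module_def by blast
    have cl: "m + m' \<in> M" "act a m \<in> M" if "m \<in> M" "m' \<in> M" for a m m'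
      using M that unfolding left_module_def by blast+
    show ?thesis
      by (auto simp: tensor_relators_def kernel_def minus_in frag_in cl p_minus p_frag add add' mult
          additive_monoid_def)
  qed
  have K_sub: "?K \<subseteq> kernel ?G ?H p"
    unfolding tensor_kernel_def
    by (rule G.generate_subgroup_incl[OF rel_sub p.subgroup_kernel])
  have K_subgroup: "subgroup ?K ?G"
    unfolding tensor_kernel_def
    by (rule G.generate_is_subgroup) (use rel_sub in \<open>auto simp: kernel_def\<close>)
  have K_add: "x + y \<in> ?K" if "x \<in> ?K" "y \<in> ?K" for x y
    using subgroup.m_closed[OF K_subgroup that] by (simp add: mult_eq)
  have K_uminus: "- x \<in> ?K" if "x \<in> ?K" for x
    using subgroup.m_inv_closed[OF K_subgroup that] subgroup.subset[OF K_subgroup] that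
    by (metis inv_eq subsetD)
  have K_rel: "x \<in> ?K" if "x \<in> tensor_relators act M" for x
    using that by (simp add: tensor_kernel_def generate.incl)
  have M0: "0 \<in> M" using M by (simp add: left_module_def)
  have K0: "frag_of (e, 0) \<in> ?K" for e
  proof -
    have "frag_of (e, 0 + 0) - frag_of (e, 0) - frag_of (e, 0) \<in> ?K"
      using M0 by (intro K_rel) (unfold tensor_relators_def, blast)
    from K_uminus[OF this] show ?thesis by simp
  qed
  have collapse: "x - frag_of (e, p x) \<in> ?K"
    if x: "x \<in> carrier ?G" and e: "\<And>a m. (a, m) \<in> X \<Longrightarrow> e * a = a"
      and X: "Poly_Mapping.keys x \<subseteq> X" "X \<subseteq> UNIV \<times> M" for x e X
  proof -
    have p_in: "p y \<in> M" if "y \<in> carrier ?G" for y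
      using p.hom_closed[OF that] by (simp add: additive_monoid_def)
    have "x \<in> carrier ?G \<and> x - frag_of (e, p x) \<in> ?K"
    proof (induction rule: frag_induction[OF X(1), case_names zero one diff])
      case zero
      have "p 0 = 0" using p.hom_one by (simp add: tensor_free_def additive_monoid_def)
      then show ?case using K_uminus[OF K0] by (simp add: carrier)
    next
      case (one z)
      obtain a m where z: "z = (a, m)" by force
      have m: "m \<in> M" and ea: "e * a = a" using one z X e by auto
      have "frag_of (e * a, m) - frag_of (e, act a m) \<in> ?K"
        using m by (intro K_rel) (unfold tensor_relators_def, blast)
      then show ?case using m by (simp add: z ea p_frag carrier)
    next
      case (diff x y)
      let ?r = "frag_of (e, p (x - y) + p y) - frag_of (e, p (x - y)) - frag_of (e, p y)"
      have "?r \<in> ?K"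
        using p_in diff minus_in by (intro K_rel) (unfold tensor_relators_def, blast)
      moreover have "x - y - frag_of (e, p (x - y)) =
          (x - frag_of (e, p x)) + - (y - frag_of (e, p y)) + ?r"
        using p_minus diff by simp
      ultimately show ?case
        using diff minus_in K_add K_uminus by presburger
    qed
    then show ?thesis by blast
  qed
  have kernel_eq: "kernel ?G ?H p = ?K"
  proof
    show "kernel ?G ?H p \<subseteq> ?K"
    proof
      fix x assume "x \<in> kernel ?G ?H p"
      then have x: "x \<in> carrier ?G" and px: "p x = 0"
        by (auto simp: kernel_def additive_monoid_def)
      obtain e where "\<forall>a\<in>fst ` Poly_Mapping.keys x. e * a = a"
        using units unfolding has_left_local_units_def by (meson finite_imageI finite_keys)
      then have "x - frag_of (e, p x) \<in> ?K"
        using x by (intro collapse[of x "Poly_Mapping.keys x"]) (auto simp: carrier)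
      from K_add[OF this K0[of e]] show "x \<in> ?K" by (simp add: px)
    qed
  qed (rule K_sub)
  have onto: "p ` carrier ?G = carrier ?H"
  proof
    show "carrier ?H \<subseteq> p ` carrier ?G"
    proof
      fix m assume "m \<in> carrier ?H"
      then have m: "m \<in> M" by (simp add: additive_monoid_def)
      from s[OF m] obtain a where "m = act a m" by blast
      then show "m \<in> p ` carrier ?G" using p_frag[OF m, of a] frag_in[OF m, of a] by (metis imageI)
    qed
  qed auto
  \<comment> \<open>With the kernel identified, the first isomorphism theorem yields the canonical map.\<close>
  let ?h = "\<lambda>X. the_elem (p ` X)"
  have "?h \<in> iso (tensor_product act M) ?H"
    using p.FactGroup_iso_set[OF onto] by (simp add: tensor_product_def kernel_eq)
  moreover have "?h (pure_tensor act M a m) = act a m" if m: "m \<in> M" for a m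
  proof -
    have "p k = 0" if "k \<in> ?K" for k
      using K_sub that by (auto simp: kernel_def additive_monoid_def)
    moreover have "p (k \<otimes>\<^bsub>?G\<^esub> frag_of (a, m)) = p k + act a m" if "k \<in> ?K" for k
      using p.hom_mult[of k "frag_of (a, m)"] that subgroup.subset[OF K_subgroup] frag_in[OF m] p_frag[OF m]
      by (auto simp: additive_monoid_def)
    ultimately have "p ` pure_tensor act M a m = {act a m}"
      using subgroup.one_closed[OF K_subgroup]
      by (auto simp: pure_tensor_def r_coset_def image_iff)
    then show ?thesis by simp
  qed
  ultimately show ?thesis
    unfolding firm_module_def by (intro conjI bexI[of _ ?h] allI ballI M)
qed

section \<open>Semisimplicity and complements\<close>

text \<open>
  The action is required to be a module structure on the whole type. Then a submodule is a subset
  closed under the operations, since the module equations are inherited. Complements and direct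
  sums are questions about the lattice of these subsets.
\<close>
locale additive_module =
  fixes act :: "'a::ring \<Rightarrow> 'm::ab_group_add \<Rightarrow> 'm"
  assumes left_module_UNIV: "left_module act UNIV"
begin

abbreviation is_submodule :: "'m set \<Rightarrow> bool" where
  "is_submodule \<equiv> left_module act"

lemma act_add: "act a (x + y) = act a x + act a y"
  and act_add_left: "act (a + b) x = act a x + act b x"
  and act_mult: "act (a * b) x = act a (act b x)"
  using left_module_UNIV by (auto simp: left_module_def)

lemma act_zero [simp]: "act a 0 = 0"
  using act_add[of a 0 0] by simp

lemma act_minus: "act a (- x) = - act a x"
  using act_add[of a x "- x"] by (simp add: eq_neg_iff_add_eq_0 add.commute)

lemma act_diff: "act a (x - y) = act a x - act a y"
  using act_add[of a x "- y"] by (simp add: act_minus)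

lemma act_sum: "act a (sum f F) = (\<Sum>i\<in>F. act a (f i))"
  by (induction F rule: infinite_finite_induct) (auto simp: act_add)

lemma is_submodule_iff:
  "is_submodule N \<longleftrightarrow> 0 \<in> N \<and> (\<forall>x\<in>N. \<forall>y\<in>N. x + y \<in> N) \<and> (\<forall>x\<in>N. - x \<in> N) \<and> (\<forall>a. \<forall>x\<in>N. act a x \<in> N)"
  unfolding left_module_def by (auto simp: act_add act_add_left act_mult)

lemma submodule_zero: "is_submodule N \<Longrightarrow> 0 \<in> N"
  and submodule_add: "is_submodule N \<Longrightarrow> x \<in> N \<Longrightarrow> y \<in> N \<Longrightarrow> x + y \<in> N"
  and submodule_minus: "is_submodule N \<Longrightarrow> x \<in> N \<Longrightarrow> - x \<in> N"
  and submodule_act: "is_submodule N \<Longrightarrow> x \<in> N \<Longrightarrow> act a x \<in> N"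
  by (auto simp: is_submodule_iff)

lemma submodule_diff: "is_submodule N \<Longrightarrow> x \<in> N \<Longrightarrow> y \<in> N \<Longrightarrow> x - y \<in> N"
  using submodule_add[of N x "- y"] by (simp add: submodule_minus)

lemma submodule_sum: "is_submodule N \<Longrightarrow> (\<And>i. i \<in> F \<Longrightarrow> f i \<in> N) \<Longrightarrow> sum f F \<in> N"
  by (induction F rule: infinite_finite_induct) (auto intro: submodule_zero submodule_add)

lemma zero_submodule: "is_submodule {0}"
  by (simp add: is_submodule_iff)

lemma submodule_Int: "is_submodule N \<Longrightarrow> is_submodule K \<Longrightarrow> is_submodule (N \<inter> K)"
  by (auto simp: is_submodule_iff)

lemma submodule_plus:
  assumes "is_submodule N" "is_submodule K"
  shows "is_submodule (N + K)"
  unfolding is_submodule_iff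
proof (intro conjI ballI allI)
  show "0 \<in> N + K" using assms by (metis add_0 set_plus_intro submodule_zero)
next
  fix x y assume "x \<in> N + K" "y \<in> N + K"
  then obtain n k n' k' where "x = n + k" "y = n' + k'" "n \<in> N" "k \<in> K" "n' \<in> N" "k' \<in> K"
    by (meson set_plus_elim)
  moreover from this have "x + y = (n + n') + (k + k')" by simp
  ultimately show "x + y \<in> N + K"
    using assms by (metis set_plus_intro submodule_add)
next
  fix x assume "x \<in> N + K"
  then obtain n k where "x = n + k" "n \<in> N" "k \<in> K" by (rule set_plus_elim)
  moreover from this have "- x = - n + - k" by simp
  ultimately show "- x \<in> N + K" using assms by (metis set_plus_intro submodule_minus)
next
  fix a x assume "x \<in> N + K"
  then obtain n k where "x = n + k" "n \<in> N" "k \<in> K" by (rule set_plus_elim)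
  then show "act a x \<in> N + K" using assms by (metis set_plus_intro submodule_act act_add)
qed

lemma subset_plus_left: "is_submodule K \<Longrightarrow> N \<subseteq> N + K"
  by (metis add.right_neutral set_plus_intro submodule_zero subsetI)

lemma subset_plus_right: "is_submodule N \<Longrightarrow> K \<subseteq> N + K"
  by (metis add_0 set_plus_intro submodule_zero subsetI)

lemma submodule_Union_chain:
  assumes "\<C> \<noteq> {}" and "\<And>N. N \<in> \<C> \<Longrightarrow> is_submodule N"
    and chain: "\<And>N K. N \<in> \<C> \<Longrightarrow> K \<in> \<C> \<Longrightarrow> N \<subseteq> K \<or> K \<subseteq> N"
  shows "is_submodule (\<Union>\<C>)"
  unfolding is_submodule_iff
proof (intro conjI ballI allI)
  fix x y assume "x \<in> \<Union>\<C>" "y \<in> \<Union>\<C>"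
  then obtain N where "N \<in> \<C>" "x \<in> N" "y \<in> N" using chain by (meson UnionE subsetD)
  then show "x + y \<in> \<Union>\<C>" using assms(2) submodule_add by blast
qed (use assms in \<open>blast intro: submodule_zero submodule_minus submodule_act\<close>)+

text \<open>
  All maximal submodules below are obtained from this form of Zorn's lemma. The closure of \<open>P\<close>
  under arbitrary nonempty unions holds for properties that bound \<open>N\<close> from above, such as
  \<open>x \<notin> N\<close>.
\<close>
lemma maximal_submodule_exists:
  assumes "is_submodule N\<^sub>0" and "P N\<^sub>0"
    and "\<And>\<C>. \<C> \<noteq> {} \<Longrightarrow> (\<And>N. N \<in> \<C> \<Longrightarrow> P N) \<Longrightarrow> P (\<Union>\<C>)"
  obtains N where "is_submodule N" "P N"
    "\<And>K. is_submodule K \<Longrightarrow> P K \<Longrightarrow> N \<subseteq> K \<Longrightarrow> K = N"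
proof -
  let ?A = "{N. is_submodule N \<and> P N}"
  have "\<exists>N\<in>?A. \<forall>K\<in>?A. N \<subseteq> K \<longrightarrow> K = N"
  proof (rule subset_Zorn_nonempty)
    fix \<C> assume "\<C> \<noteq> {}" "subset.chain ?A \<C>"
    then show "\<Union>\<C> \<in> ?A"
      using assms(3)[of \<C>] submodule_Union_chain[of \<C>] by (auto simp: subset_chain_def)
  qed (use assms in blast)
  then show ?thesis using that by blast
qed

definition simple :: "'m set \<Rightarrow> bool" where
  "simple S \<longleftrightarrow> is_submodule S \<and> S \<noteq> {0} \<and> (\<forall>T. is_submodule T \<and> T \<subseteq> S \<longrightarrow> T = {0} \<or> T = S)"

definition complement :: "'m set \<Rightarrow> 'm set \<Rightarrow> bool" where
  "complement N K \<longleftrightarrow> is_submodule K \<and> N \<inter> K = {0} \<and> N + K = UNIV"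

text \<open>
  Equivalent to the sum of all simple submodules being everything, but without mentioning sums;
  this form can be transported along module homomorphisms by taking preimages of \<open>K\<close>.
\<close>
definition spanned_by_simples :: bool where
  "spanned_by_simples \<longleftrightarrow> (\<forall>K. is_submodule K \<and> (\<forall>S. simple S \<longrightarrow> S \<subseteq> K) \<longrightarrow> K = UNIV)"

definition complemented :: bool where
  "complemented \<longleftrightarrow> (\<forall>N. is_submodule N \<longrightarrow> (\<exists>K. complement N K))"

text \<open>
  Choose \<open>K\<close> maximal with \<open>N \<inter> K = {0}\<close>. A simple \<open>S\<close> that is not inside \<open>N + K\<close> meets it in \<open>0\<close>,
  and then \<open>K + S\<close> would still meet \<open>N\<close> in \<open>0\<close>. So \<open>N + K\<close> contains all simple submodules.
\<close>
lemma complemented_if_spanned_by_simples: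
  assumes spanned_by_simples
  shows complemented
  unfolding complemented_def
proof (intro allI impI)
  fix N assume N: "is_submodule N"
  obtain K where K: "is_submodule K" "N \<inter> K = {0}"
    and max: "\<And>L. is_submodule L \<Longrightarrow> N \<inter> L = {0} \<Longrightarrow> K \<subseteq> L \<Longrightarrow> L = K"
  proof (rule maximal_submodule_exists[where P = "\<lambda>K. N \<inter> K = {0}"])
    show "is_submodule {0}" by (rule zero_submodule)
    show "N \<inter> {0} = {0}" using submodule_zero[OF N] by blast
    show "N \<inter> \<Union>\<C> = {0}" if "\<C> \<noteq> {}" "\<And>K. K \<in> \<C> \<Longrightarrow> N \<inter> K = {0}" for \<C>
      using that by blast
  qed blast
  have "S \<subseteq> N + K" if S: "simple S" for S
  proof (rule ccontr)
    assume "\<not> S \<subseteq> N + K"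
    moreover have S': "is_submodule S" using S by (simp add: simple_def)
    moreover have "is_submodule (S \<inter> (N + K))"
      using S' N K by (intro submodule_Int submodule_plus)
    ultimately have disj: "S \<inter> (N + K) = {0}"
      using S unfolding simple_def by blast
    have "N \<inter> (K + S) = {0}"
    proof
      show "N \<inter> (K + S) \<subseteq> {0}"
      proof
        fix x assume x: "x \<in> N \<inter> (K + S)"
        then obtain k s where ks: "x = k + s" "k \<in> K" "s \<in> S" by (auto elim: set_plus_elim)
        then have "s = x + (- k)" by simp
        then have "s \<in> N + K" using x ks K by (metis IntD1 set_plus_intro submodule_minus)
        then have "s = 0" using ks disj by blast
        then show "x \<in> {0}" using x ks K by auto
      qed
    qed (use N K S' in \<open>auto intro: submodule_zero submodule_plus\<close>)
    then have "K + S = K"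
      by (intro max submodule_plus subset_plus_left K(1) S')
    then have "S \<subseteq> K" using subset_plus_right[OF K(1), of S] by blast
    then show False
      using \<open>\<not> S \<subseteq> N + K\<close> subset_plus_right[OF N, of K] by blast
  qed
  then have "N + K = UNIV"
    using assms submodule_plus[OF N K(1)] unfolding spanned_by_simples_def by blast
  then show "\<exists>K. complement N K" using K unfolding complement_def by blast
qed

text \<open>The modular law: a complement of \<open>N\<close> in the whole module cuts out one in each \<open>M \<supseteq> N\<close>.\<close>
lemma relative_complement:
  assumes complemented and N: "is_submodule N" "N \<subseteq> M" and M: "is_submodule M"
  obtains K where "is_submodule K" "K \<subseteq> M" "N \<inter> K = {0}" "M = N + K"
proof -
  obtain L where L: "complement N L" using assms by (auto simp: complemented_def)
  have "M \<subseteq> N + (L \<inter> M)"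
  proof
    fix x assume x: "x \<in> M"
    obtain n l where nl: "x = n + l" "n \<in> N" "l \<in> L"
      using L unfolding complement_def by (metis UNIV_I set_plus_elim)
    have "x - n \<in> M" using x nl N by (intro submodule_diff[OF M]) auto
    then have "l \<in> M" by (simp add: nl)
    then show "x \<in> N + (L \<inter> M)" using nl by blast
  qed
  moreover have "N + (L \<inter> M) \<subseteq> M"
    using N M by (auto elim!: set_plus_elim intro: submodule_add)
  ultimately show ?thesis
    using L M N by (intro that[of "L \<inter> M"]) (auto simp: complement_def intro: submodule_Int submodule_zero)
qed

text \<open>
  Let \<open>L \<subseteq> K\<close> be maximal among the submodules that avoid a fixed \<open>x \<noteq> 0\<close> of \<open>K\<close>, and let \<open>T\<close> be a
  complement of \<open>L\<close> in \<open>K\<close>. By maximality, \<open>x \<in> L + U\<close> for each nonzero \<open>U \<subseteq> T\<close>. A proper splitting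
  \<open>T = U + V\<close> would then give \<open>x\<close> two decompositions along \<open>L\<close> and \<open>T\<close>, with second components
  in \<open>U\<close> and in \<open>V\<close>; they agree, so both are \<open>0\<close> and \<open>x \<in> L\<close>. Hence \<open>T\<close> is simple.
\<close>
lemma simple_submodule_exists:
  assumes complemented and K: "is_submodule K" "K \<noteq> {0}"
  obtains S where "simple S" "S \<subseteq> K"
proof -
  obtain x where x: "x \<in> K" "x \<noteq> 0" using K submodule_zero by blast
  obtain L where L: "is_submodule L" "L \<subseteq> K \<and> x \<notin> L"
    and max: "\<And>M. is_submodule M \<Longrightarrow> M \<subseteq> K \<and> x \<notin> M \<Longrightarrow> L \<subseteq> M \<Longrightarrow> M = L"
  proof (rule maximal_submodule_exists[where P = "\<lambda>L. L \<subseteq> K \<and> x \<notin> L"])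
    show "is_submodule {0}" by (rule zero_submodule)
  qed (use x submodule_zero[OF K(1)] in blast)+
  obtain T where T: "is_submodule T" "T \<subseteq> K" "L \<inter> T = {0}" "K = L + T"
    using relative_complement[OF assms(1), of L K] L K by blast
  have x_in: "x \<in> L + U" if "is_submodule U" "U \<subseteq> T" "U \<noteq> {0}" for U
  proof (rule ccontr)
    assume "x \<notin> L + U"
    moreover have "L + U \<subseteq> K" using T that set_plus_mono2[of L L U T] by blast
    ultimately have "L + U = L"
      by (intro max submodule_plus subset_plus_left conjI L(1) that(1))
    then have "U \<subseteq> L \<inter> T" using subset_plus_right[OF L(1), of U] that by blast
    then show False using T that submodule_zero by blast
  qed
  have "T \<noteq> {0}"
  proof
    assume "T = {0}"
    then have "K = L" using T by (simp add: set_plus_def)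
    then show False using L x by blast
  qed
  moreover have "U = {0} \<or> U = T" if U: "is_submodule U" "U \<subseteq> T" for U
  proof (rule ccontr)
    assume U': "\<not> (U = {0} \<or> U = T)"
    obtain V where V: "is_submodule V" "V \<subseteq> T" "U \<inter> V = {0}" "T = U + V"
      using relative_complement[OF assms(1) U T(1)] by blast
    have "V \<noteq> {0}"
    proof
      assume "V = {0}"
      then have "T = U" using V by (simp add: set_plus_def)
      then show False using U' by blast
    qed
    then obtain l v where lv: "x = l + v" "l \<in> L" "v \<in> V"
      using x_in V by (meson set_plus_elim)
    obtain l' u where lu: "x = l' + u" "l' \<in> L" "u \<in> U"
      using x_in U U' by (meson set_plus_elim)
    have eq: "l - l' = u - v" using lv lu by (simp add: algebra_simps)
    have "l - l' \<in> L" by (rule submodule_diff[OF L(1) lv(2) lu(2)])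
    moreover have "u - v \<in> T" using lv lu U V by (intro submodule_diff[OF T(1)]) auto
    ultimately have "u - v \<in> L \<inter> T" using eq by simp
    then have "u - v = 0" using T(3) by simp
    then have "u \<in> U \<inter> V" using lv lu by simp
    then have "x = l'" using V lu by simp
    then show False using lu L by blast
  qed
  ultimately have "simple T" using T by (simp add: simple_def)
  then show ?thesis using T that by blast
qed


text \<open>
  The summation map of \<^const>\<open>is_direct_sum\<close> and, below, its domain, for a set of submodules
  indexed by its own members.
\<close>
definition total :: "('m set \<Rightarrow>\<^sub>0 'm) \<Rightarrow> 'm" where
  "total f = (\<Sum>i\<in>Poly_Mapping.keys f. Poly_Mapping.lookup f i)"

definition choices :: "'m set set \<Rightarrow> ('m set \<Rightarrow>\<^sub>0 'm) set" where
  "choices I = {f. Poly_Mapping.keys f \<subseteq> I \<and> (\<forall>S\<in>I. Poly_Mapping.lookup f S \<in> S)}"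

definition independent :: "'m set set \<Rightarrow> bool" where
  "independent I \<longleftrightarrow> (\<forall>S\<in>I. simple S) \<and> (\<forall>f\<in>choices I. total f = 0 \<longrightarrow> f = 0)"

lemma total_superset:
  "finite F \<Longrightarrow> Poly_Mapping.keys f \<subseteq> F \<Longrightarrow> total f = (\<Sum>i\<in>F. Poly_Mapping.lookup f i)"
  unfolding total_def by (rule sum.mono_neutral_left) (auto simp: in_keys_iff)

lemma total_add: "total (f + g) = total f + total g"
proof -
  let ?F = "Poly_Mapping.keys f \<union> Poly_Mapping.keys g"
  have "total (f + g) = (\<Sum>i\<in>?F. Poly_Mapping.lookup (f + g) i)"
    by (rule total_superset) (auto dest: subsetD[OF keys_add])
  then show ?thesis
    by (simp add: lookup_add sum.distrib total_superset[of ?F])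
qed

lemma total_minus: "total (- f) = - total f"
  by (simp add: total_def sum_negf)

lemma total_single: "total (Poly_Mapping.single S s) = s"
  by (simp add: total_superset[of "{S}"])

lemma total_act: "total (Poly_Mapping.map (act a) f) = act a (total f)"
proof -
  have "total (Poly_Mapping.map (act a) f) =
      (\<Sum>i\<in>Poly_Mapping.keys f. Poly_Mapping.lookup (Poly_Mapping.map (act a) f) i)"
    by (rule total_superset) (auto simp: in_keys_iff map.rep_eq)
  then show ?thesis
    by (simp add: map.rep_eq total_def act_sum when_def in_keys_iff)
qed

lemma choices_zero: "\<forall>S\<in>I. is_submodule S \<Longrightarrow> 0 \<in> choices I"
  by (auto simp: choices_def intro: submodule_zero)

lemma choices_add: "\<forall>S\<in>I. is_submodule S \<Longrightarrow> f \<in> choices I \<Longrightarrow> g \<in> choices I \<Longrightarrow> f + g \<in> choices I"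
  by (auto simp: choices_def lookup_add intro: submodule_add dest!: subsetD[OF keys_add])

lemma choices_minus: "\<forall>S\<in>I. is_submodule S \<Longrightarrow> f \<in> choices I \<Longrightarrow> - f \<in> choices I"
  by (auto simp: choices_def intro: submodule_minus)

lemma choices_act: "\<forall>S\<in>I. is_submodule S \<Longrightarrow> f \<in> choices I \<Longrightarrow> Poly_Mapping.map (act a) f \<in> choices I"
  by (auto simp: choices_def map.rep_eq in_keys_iff subset_iff when_def
      intro: submodule_act submodule_zero split: if_splits)

lemma choices_single:
  "\<forall>S\<in>I. is_submodule S \<Longrightarrow> S \<in> I \<Longrightarrow> s \<in> S \<Longrightarrow> Poly_Mapping.single S s \<in> choices I"
  by (auto simp: choices_def lookup_single when_def intro: submodule_zero)

lemma total_choices_submodule: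
  assumes "\<forall>S\<in>I. is_submodule S"
  shows "is_submodule (total ` choices I)"
  unfolding is_submodule_iff
proof (intro conjI ballI allI)
  show "0 \<in> total ` choices I"
    using choices_zero[OF assms] by (metis imageI total_def keys_zero sum.empty)
next
  fix x y assume "x \<in> total ` choices I" "y \<in> total ` choices I"
  then show "x + y \<in> total ` choices I"
    using choices_add[OF assms] by (metis (no_types, lifting) imageE imageI total_add)
next
  fix x assume "x \<in> total ` choices I"
  then show "- x \<in> total ` choices I"
    using choices_minus[OF assms] by (metis (no_types, lifting) imageE imageI total_minus)
next
  fix a x assume "x \<in> total ` choices I"
  then show "act a x \<in> total ` choices I"
    using choices_act[OF assms] by (metis (no_types, lifting) imageE imageI total_act)
qed

text \<open>
  In a vanishing sum the component in \<open>S\<close> is minus the sum of the others, so it lies in the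
  intersection with the span of \<open>I\<close> and vanishes; the rest is a vanishing sum over \<open>I\<close>.
\<close>
lemma independent_insert:
  assumes I: "independent I" and S: "simple S" and disj: "total ` choices I \<inter> S = {0}"
  shows "independent (insert S I)"
  unfolding independent_def
proof (intro conjI ballI impI)
  show "simple T" if "T \<in> insert S I" for T
    using that I S by (auto simp: independent_def)
  have subs: "\<forall>T\<in>I. is_submodule T" using I by (auto simp: independent_def simple_def)
  fix f assume f: "f \<in> choices (insert S I)" and f0: "total f = 0"
  let ?s = "Poly_Mapping.lookup f S"
  \<comment> \<open>\<open>?g\<close> is \<open>f\<close> with its component at \<open>S\<close> erased.\<close>
  let ?g = "f + - Poly_Mapping.single S ?s"
  have keys: "Poly_Mapping.keys ?g \<subseteq> I"
  proof
    fix T assume T: "T \<in> Poly_Mapping.keys ?g"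
    then have "T \<noteq> S" by (auto simp: in_keys_iff lookup_add lookup_minus)
    then have "T \<in> Poly_Mapping.keys f"
      using T by (simp add: in_keys_iff lookup_minus lookup_single)
    then show "T \<in> I" using f \<open>T \<noteq> S\<close> by (auto simp: choices_def)
  qed
  have "Poly_Mapping.lookup ?g T \<in> T" if T: "T \<in> I" for T
  proof (cases "T = S")
    case True
    then show ?thesis using T subs by (simp add: lookup_add lookup_minus submodule_zero)
  next
    case False
    then show ?thesis using T f by (simp add: lookup_minus lookup_single choices_def)
  qed
  with keys have g: "?g \<in> choices I" by (simp add: choices_def)
  have "total ?g = - ?s"
    by (simp only: total_add total_minus total_single f0 add_0)
  then have "?s = total (- ?g)" by (simp only: total_minus minus_minus)
  then have "?s \<in> total ` choices I" using choices_minus[OF subs g] by (metis imageI)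
  moreover have "?s \<in> S" using f by (simp add: choices_def)
  ultimately have "?s = 0" using disj by blast
  then have "f = ?g" by simp
  then have "f \<in> choices I" using g by simp
  then show "f = 0" using I f0 by (simp add: independent_def)
qed

text \<open>
  A choice has finite support, so it already belongs to a single member of the chain.
\<close>
lemma independent_Union_chain:
  assumes "\<C> \<noteq> {}" and ind: "\<And>I. I \<in> \<C> \<Longrightarrow> independent I" and chain: "subset.chain \<A> \<C>"
  shows "independent (\<Union>\<C>)"
  unfolding independent_def
proof (intro conjI ballI impI)
  show "simple S" if "S \<in> \<Union>\<C>" for S using that ind by (auto simp: independent_def)
  fix f assume f: "f \<in> choices (\<Union>\<C>)" and f0: "total f = 0"
  then have "Poly_Mapping.keys f \<subseteq> \<Union>\<C>" by (simp add: choices_def)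
  from finite_subset_Union_chain[OF finite_keys this assms(1) chain]
  obtain I where I: "I \<in> \<C>" "Poly_Mapping.keys f \<subseteq> I" by blast
  then have "f \<in> choices I" using f by (auto simp: choices_def)
  then show "f = 0" using ind[OF I(1)] f0 by (simp add: independent_def)
qed

text \<open>
  The span of a maximal independent set \<open>I\<close> of simple submodules is everything: otherwise its
  complement contains a simple submodule, which could be added to \<open>I\<close>.
\<close>
lemma direct_sum_of_simples_if_complemented:
  assumes complemented
  obtains I where "\<forall>S\<in>I. simple S" and "is_direct_sum I (\<lambda>S. S) UNIV"
proof -
  have "\<exists>I\<in>Collect independent. \<forall>J\<in>Collect independent. I \<subseteq> J \<longrightarrow> J = I"
  proof (rule subset_Zorn_nonempty)
    have "independent {}" by (simp add: independent_def choices_def)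
    then show "Collect independent \<noteq> {}" by blast
  next
    fix \<C> assume "\<C> \<noteq> {}" "subset.chain (Collect independent) \<C>"
    then show "\<Union>\<C> \<in> Collect independent"
      using independent_Union_chain[of \<C> "Collect independent"] by (auto simp: subset_chain_def)
  qed
  then obtain I where I: "independent I" and max: "\<And>J. independent J \<Longrightarrow> I \<subseteq> J \<Longrightarrow> J = I"
    by blast
  have subs: "\<forall>S\<in>I. is_submodule S" using I by (auto simp: independent_def simple_def)
  let ?N = "total ` choices I"
  have N: "is_submodule ?N" by (rule total_choices_submodule[OF subs])
  obtain K where K: "is_submodule K" "?N \<inter> K = {0}" "?N + K = UNIV"
    using assms N unfolding complemented_def complement_def by blast
  have "K = {0}"
  proof (rule ccontr)
    assume "K \<noteq> {0}"
    then obtain S where S: "simple S" "S \<subseteq> K"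
      using simple_submodule_exists[OF assms K(1)] by blast
    have S0: "0 \<in> S" using S by (simp add: simple_def submodule_zero)
    then have disj: "?N \<inter> S = {0}" using S K(2) by blast
    have "S \<in> I" using max[OF independent_insert[OF I S(1) disj]] by blast
    have "s \<in> ?N" if "s \<in> S" for s
      using choices_single[OF subs \<open>S \<in> I\<close> that] by (metis imageI total_single)
    then have "S = {0}" using disj S0 by blast
    then show False using S by (simp add: simple_def)
  qed
  then have onto: "?N = UNIV" using K(3) by (simp add: set_plus_def)
  have "inj_on total (choices I)"
  proof (rule inj_onI)
    fix f g assume fg: "f \<in> choices I" "g \<in> choices I" "total f = total g"
    then have "f + - g \<in> choices I" by (intro choices_add choices_minus subs)
    moreover have "total (f + - g) = 0" by (simp only: total_add total_minus fg(3) right_minus)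
    ultimately have "f + - g = 0" using I unfolding independent_def by blast
    then show "f = g" by simp
  qed
  with onto have "bij_betw total (choices I) UNIV" by (simp add: bij_betw_def)
  then have "is_direct_sum I (\<lambda>S. S) UNIV"
    unfolding is_direct_sum_def choices_def total_def[abs_def] .
  moreover have "\<forall>S\<in>I. simple S" using I by (simp add: independent_def)
  ultimately show ?thesis by (rule that[rotated])
qed

lemma complement_projection:
  assumes N: "is_submodule N" and "complement N K"
  obtains \<pi> where "\<And>x. \<pi> x \<in> N" and "\<And>x. x \<in> N \<Longrightarrow> \<pi> x = x"
    and "\<And>x y. \<pi> (x + y) = \<pi> x + \<pi> y" and "\<And>a x. \<pi> (act a x) = act a (\<pi> x)"
proof -
  have K: "is_submodule K" and disj: "N \<inter> K = {0}" and UNIV: "N + K = UNIV"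
    using assms by (auto simp: complement_def)
  have "\<exists>n\<in>N. x - n \<in> K" for x
  proof -
    obtain n k where "x = n + k" "n \<in> N" "k \<in> K" using UNIV by (metis UNIV_I set_plus_elim)
    then show ?thesis by (intro bexI[of _ n]) auto
  qed
  then obtain \<pi> where \<pi>: "\<And>x. \<pi> x \<in> N" "\<And>x. x - \<pi> x \<in> K" by metis
  have unique: "\<pi> x = n" if "n \<in> N" "x - n \<in> K" for x n
  proof -
    have "n - \<pi> x \<in> N" using that \<pi> N by (intro submodule_diff)
    moreover have "(x - \<pi> x) - (x - n) \<in> K" by (rule submodule_diff[OF K \<pi>(2) that(2)])
    ultimately have "n - \<pi> x \<in> N \<inter> K" by simp
    then show ?thesis using disj by simp
  qed
  show ?thesis
  proof (rule that[of \<pi>])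
    show "\<pi> x = x" if "x \<in> N" for x
      using that by (intro unique) (auto simp: submodule_zero K)
    show "\<pi> (x + y) = \<pi> x + \<pi> y" for x y
    proof (rule unique)
      have "(x - \<pi> x) + (y - \<pi> y) \<in> K" using \<pi> K by (intro submodule_add)
      then show "x + y - (\<pi> x + \<pi> y) \<in> K" by (simp add: algebra_simps)
    qed (use \<pi> N in \<open>intro submodule_add\<close>)
    show "\<pi> (act a x) = act a (\<pi> x)" for a x
    proof (rule unique)
      show "act a x - act a (\<pi> x) \<in> K"
        using submodule_act[OF K \<pi>(2)[of x], of a] by (simp add: act_diff)
    qed (use \<pi> N in \<open>intro submodule_act\<close>)
  qed (rule \<pi>(1))
qed

section \<open>Firm semisimplicity in terms of all submodules\<close>

text \<open>
  S-unitality of a submodule is inherited: a witness \<open>a\<close> of \<open>m = a m\<close> does not depend on the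
  submodule containing \<open>m\<close>.
\<close>
lemma firm_module_if_submodule:
  assumes "has_left_local_units TYPE('a)" "s_unital_module act UNIV" "is_submodule N"
  shows "firm_module act N"
  using assms by (intro firm_module_if_s_unital) (auto simp: s_unital_module_def)

lemma simple_firm_module_iff_simple:
  assumes "has_left_local_units TYPE('a)" "s_unital_module act UNIV"
  shows "simple_firm_module act N \<longleftrightarrow> simple N"
proof -
  have "firm_module act T \<longleftrightarrow> is_submodule T" for T
    using firm_module_if_submodule[OF assms] by (auto simp: firm_module_def)
  then show ?thesis by (auto simp: simple_firm_module_def simple_def firm_submodule_def)
qed

lemma spanned_by_simples_if_semisimple:
  assumes "has_left_local_units TYPE('a)" "s_unital_module act UNIV"
    and "semisimple_firm_module act UNIV"
  shows spanned_by_simples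
  unfolding spanned_by_simples_def
proof (intro allI impI)
  fix K assume K: "is_submodule K \<and> (\<forall>S. simple S \<longrightarrow> S \<subseteq> K)"
  obtain I :: "'m set set" and N where "\<forall>i\<in>I. simple_firm_module act (N i)"
    and sum: "is_direct_sum I N UNIV"
    using assms(3) unfolding semisimple_firm_module_def by blast
  then have N: "N i \<subseteq> K" if "i \<in> I" for i
    using that K simple_firm_module_iff_simple[OF assms(1,2)] by blast
  have "x \<in> K" for x
  proof -
    have "x \<in> (\<lambda>f. \<Sum>i\<in>Poly_Mapping.keys f. Poly_Mapping.lookup f i) `
       {f :: 'm set \<Rightarrow>\<^sub>0 'm. Poly_Mapping.keys f \<subseteq> I \<and> (\<forall>i\<in>I. Poly_Mapping.lookup f i \<in> N i)}"
      using sum unfolding is_direct_sum_def bij_betw_def by blast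
    then show ?thesis
      using K N by (fastforce intro!: submodule_sum)
  qed
  then show "K = UNIV" by blast
qed

lemma semisimple_if_complemented:
  assumes "has_left_local_units TYPE('a)" "s_unital_module act UNIV" and complemented
  shows "semisimple_firm_module act UNIV"
proof -
  obtain I where I: "\<forall>S\<in>I. simple S" "is_direct_sum I (\<lambda>S. S) UNIV"
    using direct_sum_of_simples_if_complemented[OF assms(3)] .
  then have "\<forall>S\<in>I. firm_submodule act S UNIV \<and> simple_firm_module act S"
    using simple_firm_module_iff_simple[OF assms(1,2)]
    by (auto simp: firm_submodule_def simple_firm_module_def)
  moreover have "firm_module act UNIV"
    by (rule firm_module_if_submodule[OF assms(1,2) left_module_UNIV])
  ultimately show ?thesis
    using I(2) unfolding semisimple_firm_module_def
    by (intro conjI exI[of _ I] exI[of _ "\<lambda>S. S"])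
qed

end


section \<open>The group ring\<close>

lemma additive_module_regular: "additive_module ((*) :: 'a::ring \<Rightarrow> 'a \<Rightarrow> 'a)"
  by unfold_locales (auto simp: left_module_def algebra_simps)

lemma s_unital_regular:
  assumes "has_left_local_units TYPE('a::ring)"
  shows "s_unital_module ((*) :: 'a \<Rightarrow> 'a \<Rightarrow> 'a) UNIV"
proof -
  have "\<exists>e. m = e * m" for m :: 'a
    using assms[unfolded has_left_local_units_def, rule_format, of "{m}"] by (auto intro: sym)
  then show ?thesis
    using additive_module.left_module_UNIV[OF additive_module_regular]
    by (simp add: s_unital_module_def)
qed

text \<open>The group ring as a left module over its coefficient ring.\<close>
definition coeff_act :: "'b::ring \<Rightarrow> ('b, 'g::{finite, group_add}) group_ring \<Rightarrow> ('b, 'g) group_ring" where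
  "coeff_act b x = Poly_Mapping.single 0 b * x"

lemma additive_module_coeff_act:
  "additive_module (coeff_act :: 'b::ring \<Rightarrow> ('b, 'g::{finite, group_add}) group_ring \<Rightarrow> _)"
proof
  have "Poly_Mapping.single 0 (a * a') = Poly_Mapping.single 0 a * Poly_Mapping.single (0 :: 'g) a'"
    for a a' :: 'b by (simp add: mult_single)
  then show "left_module (coeff_act :: 'b \<Rightarrow> ('b, 'g) group_ring \<Rightarrow> _) UNIV"
    by (simp add: left_module_def coeff_act_def algebra_simps single_add)
qed

lemma single_sum_const: "Poly_Mapping.single g (\<Sum>_\<in>F. b) = (\<Sum>_\<in>F. Poly_Mapping.single g b)"
  by (induction F rule: infinite_finite_induct) (auto simp: single_add)

lemma group_ring_eq_sum:
  fixes x :: "('b::ring, 'g::{finite, group_add}) group_ring"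
  shows "x = (\<Sum>g\<in>UNIV. Poly_Mapping.single g (Poly_Mapping.lookup x g))"
  by (rule poly_mapping_eqI) (simp add: lookup_sum lookup_single when_def)

lemma group_ring_induct [case_names single add]:
  fixes x :: "('b::ring, 'g::{finite, group_add}) group_ring"
  assumes single: "\<And>g b. P (Poly_Mapping.single g b)" and add: "\<And>x y. P x \<Longrightarrow> P y \<Longrightarrow> P (x + y)"
  shows "P x"
proof -
  have "P (\<Sum>g\<in>F. Poly_Mapping.single g (Poly_Mapping.lookup x g))" for F :: "'g set"
  proof (induction F rule: infinite_finite_induct)
    case (insert g F)
    then show ?case using add single by simp
  qed (use single[of 0 0] in simp_all)
  then show ?thesis by (subst group_ring_eq_sum)
qed

text \<open>
  The elements of \<open>X\<close> have only finitely many coefficients altogether, and a common left unit of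
  these, placed at the neutral element of the group, is a left unit of every \<open>x \<in> X\<close>.
\<close>
lemma coefficient_local_unit:
  fixes X :: "('b::ring, 'g::{finite, group_add}) group_ring set"
  assumes "has_left_local_units TYPE('b)" and "finite X"
  obtains e where "\<And>x. x \<in> X \<Longrightarrow> coeff_act e x = x"
proof -
  have "finite (\<Union>x\<in>X. range (Poly_Mapping.lookup x))" using assms(2) by simp
  then obtain e :: 'b where e: "\<forall>b\<in>(\<Union>x\<in>X. range (Poly_Mapping.lookup x)). e * b = b"
    using assms(1) unfolding has_left_local_units_def by blast
  have "coeff_act e x = x" if "x \<in> X" for x
  proof -
    have "e * Poly_Mapping.lookup x g = Poly_Mapping.lookup x g" for g
      using e that by blast
    then show ?thesis
      unfolding coeff_act_def
      by (subst (1 3) group_ring_eq_sum) (simp add: sum_distrib_left mult_single)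
  qed
  then show ?thesis by (rule that)
qed

lemma group_ring_left_local_units:
  assumes "has_left_local_units TYPE('b::ring)"
  shows "has_left_local_units TYPE(('b, 'g::{finite, group_add}) group_ring)"
  unfolding has_left_local_units_def
proof (intro allI impI)
  fix X :: "('b, 'g) group_ring set" assume "finite X"
  from coefficient_local_unit[OF assms this] obtain e where "\<And>x. x \<in> X \<Longrightarrow> coeff_act e x = x"
    by blast
  then show "\<exists>e. \<forall>x\<in>X. e * x = x" unfolding coeff_act_def by blast
qed

text \<open>Restriction of scalars along \<open>b \<mapsto> single 0 b\<close>.\<close>
lemma submodule_coeff:
  fixes N :: "('b::ring, 'g::{finite, group_add}) group_ring set"
  assumes "left_module (*) N"
  shows "left_module coeff_act N"
  using assms
  unfolding additive_module.is_submodule_iff[OF additive_module_regular]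
    additive_module.is_submodule_iff[OF additive_module_coeff_act]
  by (simp add: coeff_act_def)

text \<open>
  For each \<open>g\<close> the map \<open>b \<mapsto> b g\<close> is an injective \<open>B\<close>-linear map from \<open>B\<close> to \<open>B[G]\<close>, so it carries
  simple submodules to simple submodules. A submodule \<open>K\<close> containing all simple ones therefore has
  preimage \<open>B\<close> under each of these maps, and the monomials \<open>b g\<close> generate \<open>B[G]\<close> additively.
\<close>
lemma coeff_act_spanned_by_simples:
  assumes "additive_module.spanned_by_simples ((*) :: 'b::ring \<Rightarrow> 'b \<Rightarrow> 'b)"
  shows "additive_module.spanned_by_simples
    (coeff_act :: 'b \<Rightarrow> ('b, 'g::{finite, group_add}) group_ring \<Rightarrow> _)"
proof -
  interpret B: additive_module "(*) :: 'b \<Rightarrow> 'b \<Rightarrow> 'b" by (rule additive_module_regular)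
  interpret A: additive_module "coeff_act :: 'b \<Rightarrow> ('b, 'g) group_ring \<Rightarrow> _"
    by (rule additive_module_coeff_act)
  have act_single: "coeff_act a (Poly_Mapping.single g b) = Poly_Mapping.single g (a * b)"
    for a b :: 'b and g :: 'g
    by (simp add: coeff_act_def mult_single)
  have vimage: "B.is_submodule (Poly_Mapping.single g -` K)" if K: "A.is_submodule K" for g :: 'g and K
    unfolding B.is_submodule_iff
    using A.submodule_zero[OF K] A.submodule_add[OF K] A.submodule_minus[OF K] A.submodule_act[OF K]
    by (auto simp: single_add single_uminus simp flip: act_single)
  have image: "A.is_submodule (Poly_Mapping.single g ` S)" if S: "B.is_submodule S" for g :: 'g and S
    unfolding A.is_submodule_iff
    using B.submodule_zero[OF S] B.submodule_add[OF S] B.submodule_minus[OF S] B.submodule_act[OF S]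
    by (auto simp: act_single simp flip: single_add single_uminus
        intro: image_eqI[of _ _ 0])
  have simple: "A.simple (Poly_Mapping.single g ` S)" if S: "B.simple S" for g :: 'g and S
    unfolding A.simple_def
  proof (intro conjI allI impI)
    have S': "B.is_submodule S" "S \<noteq> {0}" using S by (simp_all add: B.simple_def)
    then obtain s where "s \<in> S" "s \<noteq> 0" using B.submodule_zero by blast
    then show "Poly_Mapping.single g ` S \<noteq> {0}" by (metis imageI singletonD inj_eq inj_single single_zero)
    show "A.is_submodule (Poly_Mapping.single g ` S)" by (rule image[OF S'(1)])
    fix T assume T: "A.is_submodule T \<and> T \<subseteq> Poly_Mapping.single g ` S"
    let ?U = "Poly_Mapping.single g -` T"
    have "?U \<subseteq> S" using T by (auto simp: inj_eq[OF inj_single])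
    then have "?U = {0} \<or> ?U = S" using S vimage T unfolding B.simple_def by blast
    moreover have "T = Poly_Mapping.single g ` ?U" using T by blast
    ultimately show "T = {0} \<or> T = Poly_Mapping.single g ` S" by (metis image_empty image_insert single_zero)
  qed
  show ?thesis
    unfolding A.spanned_by_simples_def
  proof (intro allI impI)
    fix K assume K: "A.is_submodule K \<and> (\<forall>S. A.simple S \<longrightarrow> S \<subseteq> K)"
    have "Poly_Mapping.single g -` K = UNIV" for g :: 'g
      using assms vimage[of K g] simple[of _ g] K unfolding B.spanned_by_simples_def by blast
    then have monomial: "Poly_Mapping.single g b \<in> K" for g :: 'g and b by blast
    have "x \<in> K" for x
    proof (induction x rule: group_ring_induct)
      case (single g b)
      show ?case by (rule monomial)
    next
      case (add x y)
      then show ?case using K by (intro A.submodule_add) auto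
    qed
    then show "K = UNIV" by blast
  qed
qed

section \<open>Maschke's averaging argument\<close>

text \<open>
  Left multiplication by the group element \<open>g\<close>. It is given on coefficients, because without a
  unit in \<open>B\<close> there is no element \<open>1 g\<close> of \<open>B[G]\<close> to multiply with.
\<close>
definition translate :: "'g \<Rightarrow> ('b::ring, 'g::{finite, group_add}) group_ring \<Rightarrow> ('b, 'g) group_ring" where
  "translate g x = Poly_Mapping.map_key (\<lambda>h. - g + h) x"

lemma lookup_translate: "Poly_Mapping.lookup (translate g x) h = Poly_Mapping.lookup x (- g + h)"
  by (simp add: translate_def map_key.rep_eq inj_on_def)

lemma translate_add: "translate g (x + y) = translate g x + translate g y"
  by (rule poly_mapping_eqI) (simp add: lookup_translate lookup_add)

lemma translate_translate: "translate g (translate h x) = translate (g + h) x"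
  by (rule poly_mapping_eqI) (simp add: lookup_translate minus_add add.assoc del: add_uminus_conv_diff)

lemma translate_zero: "translate 0 x = x"
  by (rule poly_mapping_eqI) (simp add: lookup_translate)

lemma translate_single: "translate g (Poly_Mapping.single h b) = Poly_Mapping.single (g + h) b"
proof (rule poly_mapping_eqI)
  fix k
  have "h = - g + k \<longleftrightarrow> g + h = k" by (metis add.assoc add_0 left_minus right_minus)
  then show "Poly_Mapping.lookup (translate g (Poly_Mapping.single h b)) k =
      Poly_Mapping.lookup (Poly_Mapping.single (g + h) b) k"
    by (simp add: lookup_translate lookup_single when_def)
qed

lemma translate_coeff_act: "translate g (coeff_act b x) = coeff_act b (translate g x)"
  by (induction x rule: group_ring_induct)
    (simp_all add: coeff_act_def mult_single translate_single translate_add distrib_left)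

lemma single_mult_eq: "Poly_Mapping.single g b * x = coeff_act b (translate g x)"
  by (induction x rule: group_ring_induct)
    (simp_all add: coeff_act_def mult_single translate_single translate_add distrib_left)

lemma sum_translate: "translate g (sum f F) = (\<Sum>i\<in>F. translate g (f i))"
proof -
  have "translate g 0 = 0" using translate_add[of g 0 0] by simp
  then show ?thesis by (induction F rule: infinite_finite_induct) (auto simp: translate_add)
qed

text \<open>Translation by \<open>g\<close> agrees on \<open>x\<close> with multiplication by \<open>e g\<close>, for a left unit \<open>e\<close> of \<open>x\<close>.\<close>
lemma translate_mem_submodule:
  fixes N :: "('b::ring, 'g::{finite, group_add}) group_ring set"
  assumes "has_left_local_units TYPE('b)" and N: "left_module (*) N" and x: "x \<in> N"
  shows "translate g x \<in> N"
proof -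
  obtain e where "coeff_act e x = x" using coefficient_local_unit[OF assms(1), of "{x}"] by auto
  then have "translate g x = Poly_Mapping.single g e * x"
    by (metis single_mult_eq translate_coeff_act)
  then show ?thesis
    using additive_module.submodule_act[OF additive_module_regular N x] by simp
qed

text \<open>A right unit \<open>e = n c\<close> of \<open>b\<close> gives \<open>b = b (n c) = (n b) c\<close>.\<close>
lemma nat_multiple_inject_zero:
  fixes b :: "'b::ring"
  assumes "has_local_units TYPE('b)" and surj: "{nat_multiple n b | b. True} = (UNIV :: 'b set)"
    and "nat_multiple n b = 0"
  shows "b = 0"
proof -
  obtain e where e: "b * e = b"
    using assms(1)[unfolded has_local_units_def, rule_format, of "{b}"] by auto
  obtain c where "e = nat_multiple n c" using surj by blast
  then have "b * e = nat_multiple n b * c"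
    by (simp add: nat_multiple_def sum_distrib_left sum_distrib_right)
  then show ?thesis using e assms(3) by simp
qed

lemma nat_multiple_card: "finite F \<Longrightarrow> nat_multiple (card F) b = (\<Sum>_\<in>F. b)"
  by (induction F rule: finite_induct) (auto simp: nat_multiple_def add.commute)

lemma lookup_nat_multiple:
  "Poly_Mapping.lookup (nat_multiple n x) g = nat_multiple n (Poly_Mapping.lookup x g)"
  by (simp add: nat_multiple_def lookup_sum)

text \<open>
  The complement of \<open>N\<close> is the kernel of the averaged projection \<open>P\<close>. Since \<open>P\<close> is multiplication by
  \<open>|G|\<close> on \<open>N\<close>, injectivity of this multiplication makes the intersection trivial. For the sum,
  write \<open>P x = |G| y\<close> with \<open>y \<in> N\<close>; then \<open>x - y\<close> is in the kernel.
\<close>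
lemma group_ring_complemented:
  assumes units: "has_local_units TYPE('b::ring)"
    and surj: "{nat_multiple CARD('g::{finite, group_add}) b | b. True} = (UNIV :: 'b set)"
    and compl: "additive_module.complemented (coeff_act :: 'b \<Rightarrow> ('b, 'g) group_ring \<Rightarrow> _)"
  shows "additive_module.complemented ((*) :: ('b, 'g) group_ring \<Rightarrow> _)"
proof -
  interpret B: additive_module "coeff_act :: 'b \<Rightarrow> ('b, 'g) group_ring \<Rightarrow> _"
    by (rule additive_module_coeff_act)
  interpret A: additive_module "(*) :: ('b, 'g) group_ring \<Rightarrow> _"
    by (rule additive_module_regular)
  have lunits: "has_left_local_units TYPE('b)" by (rule has_local_units_imp_left[OF units])
  let ?n = "nat_multiple CARD('g) :: ('b, 'g) group_ring \<Rightarrow> _"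
  have n_inj: "x = 0" if "?n x = 0" for x
  proof (rule poly_mapping_eqI)
    fix g
    have "nat_multiple CARD('g) (Poly_Mapping.lookup x g) = 0"
      using that by (simp flip: lookup_nat_multiple)
    then show "Poly_Mapping.lookup x g = Poly_Mapping.lookup 0 g"
      using nat_multiple_inject_zero[OF units surj] by simp
  qed
  have n_divisible: "\<exists>y\<in>N. x = ?n y" if "A.is_submodule N" "x \<in> N" for N x
  proof -
    obtain e where e: "coeff_act e x = x"
      using coefficient_local_unit[OF lunits, of "{x}"] by auto
    obtain c where "e = nat_multiple CARD('g) c" using surj by blast
    then have "coeff_act e x = ?n (coeff_act c x)"
      by (simp add: nat_multiple_def coeff_act_def single_sum_const sum_distrib_right)
    moreover have "coeff_act c x \<in> N"
      using A.submodule_act[OF that] by (simp add: coeff_act_def)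
    ultimately show ?thesis using e by metis
  qed
  show ?thesis
    unfolding A.complemented_def
  proof (intro allI impI)
    fix N :: "('b, 'g) group_ring set" assume N: "A.is_submodule N"
    have N': "B.is_submodule N" by (rule submodule_coeff[OF N])
    obtain K where K: "B.complement N K" using compl N' unfolding B.complemented_def by blast
    obtain \<pi> where \<pi>: "\<And>x. \<pi> x \<in> N" "\<And>x. x \<in> N \<Longrightarrow> \<pi> x = x"
      "\<And>x y. \<pi> (x + y) = \<pi> x + \<pi> y" "\<And>b x. \<pi> (coeff_act b x) = coeff_act b (\<pi> x)"
      using B.complement_projection[OF N' K] by blast
    define P where "P x = (\<Sum>g\<in>UNIV. translate g (\<pi> (translate (- g) x)))" for x
    have P_add: "P (x + y) = P x + P y" for x y
      by (simp add: P_def translate_add \<pi>(3) sum.distrib)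
    have P_zero: "P 0 = 0" using P_add[of 0 0] by simp
    have P_minus: "P (- x) = - P x" for x
      using P_add[of x "- x"] P_zero by (simp add: eq_neg_iff_add_eq_0 add.commute)
    have P_coeff: "P (coeff_act b x) = coeff_act b (P x)" for b x
      by (simp add: P_def translate_coeff_act \<pi>(4) B.act_sum)
    have P_translate: "P (translate h x) = translate h (P x)" for h x
    proof -
      \<comment> \<open>The substitution \<open>g \<mapsto> h g\<close> permutes the summands.\<close>
      have "P (translate h x) = (\<Sum>g\<in>UNIV. translate (h + g) (\<pi> (translate (- (h + g)) (translate h x))))"
        unfolding P_def
        by (rule sum.reindex_bij_witness[of _ "\<lambda>g. h + g" "\<lambda>g. - h + g"])
          (simp_all flip: add.assoc)
      also have "\<dots> = (\<Sum>g\<in>UNIV. translate h (translate g (\<pi> (translate (- g) x))))"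
        by (simp add: translate_translate minus_add add.assoc del: add_uminus_conv_diff)
      finally show ?thesis by (simp add: P_def sum_translate)
    qed
    have P_mult: "P (a * x) = a * P x" for a x
      by (induction a rule: group_ring_induct)
        (simp_all add: single_mult_eq P_coeff P_translate distrib_right P_add)
    have P_in: "P x \<in> N" for x
      unfolding P_def
      by (intro A.submodule_sum N translate_mem_submodule[OF lunits N] \<pi>(1))
    have P_N: "P x = ?n x" if "x \<in> N" for x
    proof -
      have "translate g (\<pi> (translate (- g) x)) = x" for g
        using translate_mem_submodule[OF lunits N that, of "- g"]
        by (simp add: \<pi>(2) translate_translate translate_zero)
      then show ?thesis by (simp add: P_def nat_multiple_card)
    qed
    let ?L = "{x. P x = 0}"
    have L: "A.is_submodule ?L"
      unfolding A.is_submodule_iff by (simp add: P_zero P_add P_minus P_mult)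
    moreover have "N \<inter> ?L = {0}"
      using n_inj P_N P_zero A.submodule_zero[OF N] by auto
    moreover have "x \<in> N + ?L" for x
    proof -
      obtain y where y: "y \<in> N" "P x = ?n y" using n_divisible[OF N P_in] by blast
      have "P (x + - y) = 0" using y P_N by (simp only: P_add P_minus) simp
      then have "y + (x + - y) \<in> N + ?L" using y by (intro set_plus_intro) auto
      then show ?thesis by simp
    qed
    ultimately show "\<exists>K. A.complement N K" unfolding A.complement_def by blast
  qed
qed

theorem theorem6:
  assumes "has_local_units TYPE('b::ring)"
    and "left_semisimple_ring TYPE('b)"
    and "{nat_multiple CARD('g::{finite, group_add}) b | b. True} = (UNIV :: 'b set)"
  shows "left_semisimple_ring TYPE(('b, 'g) group_ring)"
proof -
  have units: "has_left_local_units TYPE('b)"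
    by (rule has_local_units_imp_left[OF assms(1)])
  then have A_units: "has_left_local_units TYPE(('b, 'g) group_ring)"
    by (rule group_ring_left_local_units)
  have "additive_module.spanned_by_simples ((*) :: 'b \<Rightarrow> 'b \<Rightarrow> 'b)"
    using assms(2) s_unital_regular[OF units] unfolding left_semisimple_ring_def
    by (intro additive_module.spanned_by_simples_if_semisimple[OF additive_module_regular units]) auto
  then have "additive_module.complemented (coeff_act :: 'b \<Rightarrow> ('b, 'g) group_ring \<Rightarrow> _)"
    by (intro additive_module.complemented_if_spanned_by_simples additive_module_coeff_act
        coeff_act_spanned_by_simples)
  then have "additive_module.complemented ((*) :: ('b, 'g) group_ring \<Rightarrow> _)"
    by (rule group_ring_complemented[OF assms(1,3)])
  then show ?thesis
    using additive_module.semisimple_if_complemented[OF additive_module_regular A_units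
        s_unital_regular[OF A_units]] s_unital_regular[OF A_units]
    by (simp add: left_semisimple_ring_def left_s_unital_ring_def)
qed

end
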